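(* Let $n,m$ be positive integers, $k\in\{2,\dots,\min\{n,m\}\}$, $U=\{u_1,\dots,u_n\}$, $V=\{v_1,\dots,v_m\}$, and fix a parameter $p\in\{1,\dots,k\}$. Then the hypermetric inequalities $$\sum_{\substack{u_j,u_h\in Q_U \\ j<h}}(Z_{UU})_{jh}\ \ge\ \sum_{u_j\in Q_U}(Z_{UU})_{ij}-(Z_{UU})_{ii}\qquad\forall u_i\in U,\ \forall Q_U\subseteq U\setminus\{u_i\}:\ 1\le|Q_U|\le p,$$ $$\sum_{\substack{v_j,v_h\in Q_V \\ j<h}}(Z_{VV})_{jh}\ \ge\ \sum_{v_j\in Q_V}(Z_{VV})_{ij}-(Z_{VV})_{ii}\qquad\forall v_i\in V,\ \forall Q_V\subseteq V\setminus\{v_i\}:\ 1\le|Q_V|\le p$$ are valid for (i.e. satisfied by every feasible solution $Z$ of) the rank-constrained problem $\max\{\frac12\mathrm{tr}(WZ): Z\in\mathcal{P},\ \mathrm{rank}(Z)=k\}$.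
   Context: $\mathcal{P}$ is the set of all real symmetric block matrices $Z=\begin{bmatrix} Z_{UU} & Z_{UV} \\ Z_{UV}^\top & Z_{VV} \end{bmatrix}$ of size $(n+m)\times(n+m)$ (with $Z_{UU}$ of size $n\times n$, $Z_{VV}$ of size $m\times m$, $Z_{UV}$ of size $n\times m$) such that $Z_{UU}1_n=1_n$, $Z_{VV}1_m=1_m$, $\mathrm{tr}(Z_{UU})=k$, $\mathrm{tr}(Z_{VV})=k$, $Z\ge0$ entrywise, and $Z$ is positive semidefinite. Here $1_N$ is the all-ones vector in $\mathbb{R}^N$. $W=\begin{bmatrix} 0 & A \\ A^\top & 0 \end{bmatrix}$ for a given data matrix $A\in\mathbb{R}^{n\times m}$. Row/column $i$ of $Z_{UU}$ corresponds to $u_i$ and row/column $i$ of $Z_{VV}$ to $v_i$. *)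

theory Defs
  imports "HOL-Analysis.Analysis"
begin

text \<open>
  The sets \<open>U\<close> and \<open>V\<close> are identified with finite linearly ordered index types \<open>'n\<close> and \<open>'m\<close>
  (\<open>u\<^sub>i\<close>, \<open>v\<^sub>i\<close> being the element \<open>i\<close>), so that \<open>n = CARD('n)\<close> and \<open>m = CARD('m)\<close>.
  A matrix of size \<open>(n + m) \<times> (n + m)\<close> is indexed by the sum type \<open>'n + 'm\<close>, which makes its
  block structure visible.
\<close>

definition block_matrix ::
  "'a^'n^'n \<Rightarrow> 'a^'m^'n \<Rightarrow> 'a^'n^'m \<Rightarrow> 'a^'m^'m \<Rightarrow> 'a^('n::finite + 'm::finite)^('n::finite + 'm::finite)" where
  "block_matrix P Q R S = (\<chi> a b.
     case a of
       Inl i \<Rightarrow> (case b of Inl j \<Rightarrow> P $ i $ j | Inr j \<Rightarrow> Q $ i $ j)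
     | Inr i \<Rightarrow> (case b of Inl j \<Rightarrow> R $ i $ j | Inr j \<Rightarrow> S $ i $ j))"

definition block_UU :: "'a^('n::finite + 'm::finite)^('n::finite + 'm::finite) \<Rightarrow> 'a^'n^'n" where
  "block_UU Z = (\<chi> i j. Z $ Inl i $ Inl j)"

definition block_VV :: "'a^('n::finite + 'm::finite)^('n::finite + 'm::finite) \<Rightarrow> 'a^'m^'m" where
  "block_VV Z = (\<chi> i j. Z $ Inr i $ Inr j)"

definition pos_semidef :: "real^'a^'a \<Rightarrow> bool" where
  "pos_semidef X \<longleftrightarrow> transpose X = X \<and> (\<forall>x. 0 \<le> x \<bullet> (X *v x))"

text \<open>Note that \<open>1\<close> of type \<open>real^'n\<close> is the all-ones vector.\<close>

definition relaxed_feasible_set :: "nat \<Rightarrow> (real^('n::finite + 'm::finite)^('n::finite + 'm::finite)) set" where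
  "relaxed_feasible_set k = {Z.
     transpose Z = Z \<and>
     block_UU Z *v 1 = 1 \<and> block_VV Z *v 1 = 1 \<and>
     trace (block_UU Z) = real k \<and> trace (block_VV Z) = real k \<and>
     (\<forall>a b. 0 \<le> Z $ a $ b) \<and>
     pos_semidef Z}"

definition bipartite_weights :: "real^'m^'n \<Rightarrow> real^('n::finite + 'm::finite)^('n::finite + 'm::finite)" where
  "bipartite_weights A = block_matrix 0 A (transpose A) 0"

datatype 'z max_problem =
  Maximize (objective: "'z \<Rightarrow> real") (feasible_set: "'z set")

definition valid_for :: "'z max_problem \<Rightarrow> ('z \<Rightarrow> bool) \<Rightarrow> bool" where
  "valid_for pb ineq \<longleftrightarrow> (\<forall>Z \<in> feasible_set pb. ineq Z)"

definition rank_problem ::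
  "real^'m^'n \<Rightarrow> nat \<Rightarrow> (real^('n::finite + 'm::finite)^('n::finite + 'm::finite)) max_problem" where
  "rank_problem A k = Maximize
     (\<lambda>Z. 1 / 2 * trace (bipartite_weights A ** Z))
     {Z \<in> relaxed_feasible_set k. rank Z = k}"

end

theory Submission
  imports Defs
begin

text \<open>
  The quadratic form of a symmetric stochastic matrix \<open>X\<close> is bounded by the squared norm. Since
  the trace is the sum of the form over an orthonormal basis of the range, a trace at least as
  large as the rank forces equality on the range, where \<open>X\<close> is then the identity; so \<open>X\<close> is
  idempotent. Idempotency makes the largest entry of each column the diagonal one, and constant on
  the support of the column, so \<open>X\<close> is block diagonal with constant blocks. If \<open>C\<close> is the part of
  \<open>Q\<close> in the block of \<open>i\<close>, the right-hand side of the hypermetric inequality is \<open>|C| - 1\<close> times the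
  entry of that block, and the pairs containing the least element of \<open>C\<close> already contribute this
  much to the left-hand side.
\<close>

text \<open>Every column of \<open>X\<close> lies in \<open>span B\<close>, so it equals its
  orthogonal expansion over \<open>B\<close>. Reading the diagonal entries off these expansions and
  exchanging the sums gives the quadratic forms.\<close>

lemma trace_eq_sum_orthonormal_range:
  fixes X :: "real^'n^'n"
  assumes "finite B" and orth: "pairwise orthogonal B" and norm1: "\<And>e. e \<in> B \<Longrightarrow> norm e = 1"
    and range: "range ((*v) X) \<subseteq> span B"
  shows "trace X = (\<Sum>e\<in>B. e \<bullet> (X *v e))"
proof -
  have diag: "X $ a $ a = (\<Sum>e\<in>B. (\<Sum>b\<in>UNIV. X $ b $ a * e $ b) * e $ a)" for a
  proof -
    let ?c = "column a X"
    have "?c \<in> span B"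
      using range by (metis matrix_vector_mult_basis rangeI subsetD)
    then have "?c = (\<Sum>e\<in>B. (?c \<bullet> e) *\<^sub>R e)"
      using orthonormal_basis_expand[OF orth norm1 _ \<open>finite B\<close>, of ?c] by simp
    then have "?c $ a = (\<Sum>e\<in>B. (?c \<bullet> e) *\<^sub>R e) $ a"
      by (rule arg_cong)
    then show ?thesis
      by (simp add: column_def inner_vec_def)
  qed
  have "trace X = (\<Sum>a\<in>UNIV. \<Sum>e\<in>B. (\<Sum>b\<in>UNIV. X $ b $ a * e $ b) * e $ a)"
    unfolding trace_def using diag by (rule sum.cong[OF refl])
  also have "\<dots> = (\<Sum>e\<in>B. \<Sum>b\<in>UNIV. \<Sum>a\<in>UNIV. X $ b $ a * e $ b * e $ a)"
    by (subst sum.swap, rule sum.cong[OF refl], subst sum.swap) (simp add: sum_distrib_right)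
  also have "\<dots> = (\<Sum>e\<in>B. e \<bullet> (X *v e))"
    by (simp add: inner_vec_def matrix_vector_mult_def sum_distrib_left mult_ac)
  finally show ?thesis .
qed

text \<open>Collects what the two diagonal blocks have in common, so that the cases of U and V are
  treated at once.\<close>

locale symmetric_stochastic =
  fixes X :: "real^'n^'n"
  assumes sym: "transpose X = X" and row_sum: "X *v 1 = 1" and nonneg: "0 \<le> X $ i $ j"
begin

lemma entry_sym: "X $ i $ j = X $ j $ i"
  by (metis sym transpose_def vec_lambda_beta)

lemma sum_row: "(\<Sum>j\<in>UNIV. X $ i $ j) = 1"
  using arg_cong[OF row_sum, of "\<lambda>x. x $ i"] by (simp add: matrix_vector_mult_def)

lemma sum_col: "(\<Sum>i\<in>UNIV. X $ i $ j) = 1"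
  using sum_row[of j] by (simp add: entry_sym)

text \<open>The Dirichlet form of the graph with edge weights \<open>X\<close>, whose Laplacian is I
  - X. As its terms are nonnegative, it gives both the bound on the quadratic form and the case of
  equality.\<close>

lemma dirichlet_form:
  "(\<Sum>i\<in>UNIV. \<Sum>j\<in>UNIV. X $ i $ j * (x $ i - x $ j)\<^sup>2) = 2 * (x \<bullet> x - x \<bullet> (X *v x))"
proof -
  have "(\<Sum>i\<in>UNIV. \<Sum>j\<in>UNIV. X $ i $ j * (x $ i - x $ j)\<^sup>2)
      = (\<Sum>i\<in>UNIV. \<Sum>j\<in>UNIV. X $ i $ j * (x $ i)\<^sup>2) + (\<Sum>i\<in>UNIV. \<Sum>j\<in>UNIV. X $ i $ j * (x $ j)\<^sup>2)
        - 2 * (\<Sum>i\<in>UNIV. \<Sum>j\<in>UNIV. x $ i * (X $ i $ j * x $ j))"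
    by (simp add: power2_diff algebra_simps sum.distrib sum_subtractf sum_distrib_left)
  also have "(\<Sum>i\<in>UNIV. \<Sum>j\<in>UNIV. X $ i $ j * (x $ i)\<^sup>2) = x \<bullet> x"
    by (simp add: sum_distrib_right[symmetric] sum_row inner_vec_def power2_eq_square)
  also have "(\<Sum>i\<in>UNIV. \<Sum>j\<in>UNIV. X $ i $ j * (x $ j)\<^sup>2) = x \<bullet> x"
    by (subst sum.swap)
       (simp add: sum_distrib_right[symmetric] sum_col inner_vec_def power2_eq_square)
  also have "(\<Sum>i\<in>UNIV. \<Sum>j\<in>UNIV. x $ i * (X $ i $ j * x $ j)) = x \<bullet> (X *v x)"
    by (simp add: inner_vec_def matrix_vector_mult_def sum_distrib_left)
  finally show ?thesis by simp
qed

lemma inner_mult_le: "x \<bullet> (X *v x) \<le> x \<bullet> x"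
proof -
  have "0 \<le> (\<Sum>i\<in>UNIV. \<Sum>j\<in>UNIV. X $ i $ j * (x $ i - x $ j)\<^sup>2)"
    by (intro sum_nonneg mult_nonneg_nonneg nonneg) simp
  then show ?thesis by (simp add: dirichlet_form)
qed

text \<open>Equality makes every term of the Dirichlet form vanish, so \<open>x\<close> is constant
  along edges of positive weight, and averaging over row i returns \<open>x $ i\<close>.\<close>

lemma fixed_if_inner_eq:
  assumes "x \<bullet> (X *v x) = x \<bullet> x"
  shows "X *v x = x"
proof -
  have "(\<Sum>i\<in>UNIV. \<Sum>j\<in>UNIV. X $ i $ j * (x $ i - x $ j)\<^sup>2) = 0"
    using assms by (simp add: dirichlet_form)
  then have "X $ i $ j * (x $ i - x $ j)\<^sup>2 = 0" for i j
    by (simp add: sum_nonneg_eq_0_iff sum_nonneg nonneg)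
  then have "X $ i $ j * x $ j = X $ i $ j * x $ i" for i j
    by (metis eq_iff_diff_eq_0 mult_eq_0_iff power_eq_0_iff)
  then have "(X *v x) $ i = (\<Sum>j\<in>UNIV. X $ i $ j) * x $ i" for i
    unfolding matrix_vector_mult_def sum_distrib_right vec_lambda_beta by (rule sum.cong[OF refl])
  then show ?thesis by (simp add: vec_eq_iff sum_row)
qed

lemma idempotent_if_rank_le_trace:
  assumes "real (rank X) \<le> trace X"
  shows "X ** X = X"
proof -
  obtain B where B: "B \<subseteq> range ((*v) X)" "pairwise orthogonal B" "\<And>e. e \<in> B \<Longrightarrow> norm e = 1"
      "independent B" "card B = dim (range ((*v) X))" "span B = range ((*v) X)"
    using orthonormal_basis_subspace[of "range ((*v) X)"]
    by (metis linear_subspace_image matrix_vector_mul_linear subspace_UNIV)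
  have fin: "finite B"
    using B(4) by (rule independent_imp_finite)
  have self: "e \<bullet> e = 1" if "e \<in> B" for e
    using B(3)[OF that] by (simp add: norm_eq_1)
  \<comment> \<open>\<open>B\<close> has \<open>rank X\<close> elements, so the hypothesis bounds
    the sum of the forms below by the size of \<open>B\<close>, while each form is at most 1. Hence
    each equals 1.\<close>
  have "(\<Sum>e\<in>B. 1) \<le> (\<Sum>e\<in>B. e \<bullet> (X *v e))"
    using assms B(5) trace_eq_sum_orthonormal_range[OF fin B(2,3)] B(6)
    by (simp add: rank_dim_range)
  then have "(\<Sum>e\<in>B. 1 - e \<bullet> (X *v e)) \<le> 0"
    by (simp add: sum_subtractf)
  moreover have ge0: "0 \<le> 1 - e \<bullet> (X *v e)" if "e \<in> B" for e
    using inner_mult_le[of e] self[OF that] by simp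
  ultimately have "(\<Sum>e\<in>B. 1 - e \<bullet> (X *v e)) = 0"
    by (meson antisym sum_nonneg)
  then have "e \<bullet> (X *v e) = e \<bullet> e" if "e \<in> B" for e
    using sum_nonneg_0[OF fin ge0] that self[OF that] by fastforce
  then have "X *v e = e" if "e \<in> B" for e
    using fixed_if_inner_eq that by blast
  then have "X *v y = y" if "y \<in> span B" for y
    using linear_eq_on[OF matrix_vector_mul_linear linear_id that] by simp
  then have "X *v (X *v x) = X *v x" for x
    using B(6) by blast
  then show ?thesis
    by (simp add: matrix_eq matrix_vector_mul_assoc)
qed

context
  assumes idem: "X ** X = X"
begin

lemma entry_eq_sum: "X $ i $ j = (\<Sum>h\<in>UNIV. X $ i $ h * X $ h $ j)"
  using arg_cong[OF idem, of "\<lambda>Y. Y $ i $ j"] by (simp add: matrix_matrix_mult_def)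

lemma entry_eq_diag:
  assumes "0 < X $ i $ j"
  shows "X $ i $ j = X $ j $ j"
proof -
  define M where "M = Max (range (\<lambda>h. X $ h $ j))"
  have le_M: "X $ h $ j \<le> M" for h
    by (simp add: M_def)
  \<comment> \<open>A row in which column \<open>j\<close> is maximal averages column \<open>j\<close>, so only maximal entries have weight.\<close>
  have propagate: "X $ h $ j = M" if "X $ t $ j = M" "0 < X $ t $ h" for t h
  proof -
    have "(\<Sum>h\<in>UNIV. X $ t $ h * (M - X $ h $ j)) = M * (\<Sum>h\<in>UNIV. X $ t $ h) - X $ t $ j"
      by (simp add: entry_eq_sum[of t j] algebra_simps sum_subtractf sum_distrib_left)
    also have "\<dots> = 0"
      using that by (simp add: sum_row)
    finally have "X $ t $ h * (M - X $ h $ j) = 0"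
      by (subst (asm) sum_nonneg_eq_0_iff) (auto simp: le_M nonneg)
    with that show ?thesis by simp
  qed
  have "M \<in> range (\<lambda>h. X $ h $ j)"
    unfolding M_def by (rule Max_in) auto
  then obtain t where t: "X $ t $ j = M" by auto
  \<comment> \<open>Since \<open>X $ t $ j = M\<close>, positivity of \<open>M\<close> lets
    \<open>propagate\<close> pass from t to j. By symmetry \<open>X $ j $ i\<close> is positive too,
    so a second use passes from j to i.\<close>
  have "0 < M"
    using assms le_M[of i] by linarith
  then have "X $ j $ j = M"
    using propagate t by auto
  then show ?thesis
    using propagate assms entry_sym by metis
qed

text \<open>Having a positive entry is a transitive relation: by idempotency
  \<open>X $ j $ h\<close> is at least the single product through i. Applying
  \<open>entry_eq_diag\<close> to (i, h) and (h, i) then identifies the two diagonal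
  entries.\<close>

lemma entry_eq_block:
  assumes "0 < X $ i $ j" and "0 < X $ i $ h"
  shows "X $ j $ h = X $ i $ i"
proof -
  have "0 < X $ j $ i * X $ i $ h"
    using assms entry_sym[of i j] by simp
  also have "\<dots> \<le> X $ j $ h"
    unfolding entry_eq_sum[of j h] by (rule member_le_sum) (auto simp: nonneg)
  finally have "X $ j $ h = X $ h $ h"
    by (rule entry_eq_diag)
  also have "\<dots> = X $ i $ i"
    using entry_eq_diag[of i h] entry_eq_diag[of h i] assms entry_sym[of i h] by simp
  finally show ?thesis .
qed

end

end

lemma hypermetric_if_idempotent:
  fixes X :: "real^('n::{finite,linorder})^('n::{finite,linorder})"
  assumes "symmetric_stochastic X" and idem: "X ** X = X"
  shows "(\<Sum>j\<in>Q. X $ i $ j) - X $ i $ i \<le> (\<Sum>(j, h) | j \<in> Q \<and> h \<in> Q \<and> j < h. X $ j $ h)"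
    (is "_ \<le> (\<Sum>(j, h) | ?P j h. _)")
proof -
  interpret symmetric_stochastic X by fact
  define C where "C = {j \<in> Q. 0 < X $ i $ j}"
  have block: "X $ j $ h = X $ i $ i" if "j \<in> C" "h \<in> C" for j h
    using that entry_eq_block[OF idem] by (simp add: C_def)
  have entry: "X $ i $ j = X $ i $ i" if "j \<in> C" for j
    using that entry_eq_diag[OF idem, of i j] block[of j j] by (simp add: C_def)
  have "(\<Sum>j\<in>Q. X $ i $ j) = (\<Sum>j\<in>C. X $ i $ j)"
    using nonneg[of i] by (intro sum.mono_neutral_right) (auto simp: C_def less_eq_real_def)
  also have "\<dots> = real (card C) * X $ i $ i"
    using entry by simp
  finally have row: "(\<Sum>j\<in>Q. X $ i $ j) = real (card C) * X $ i $ i" .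
  show ?thesis
  proof (cases "C = {}")
    case True
    have "0 \<le> (\<Sum>(j, h) | ?P j h. X $ j $ h)"
      by (rule sum_nonneg) (auto simp: nonneg)
    then show ?thesis
      using row True nonneg[of i i] by simp
  next
    case False
    define c where "c = Min C"
    have c: "c \<in> C"
      unfolding c_def using False by (intro Min_in) auto
    have pairs: "Pair c ` (C - {c}) \<subseteq> {(j, h). ?P j h}"
      using c by (auto simp: C_def c_def intro: Min_le order.not_eq_order_implies_strict)
    \<comment> \<open>All |C| - 1 summands on the right equal \<open>X $ i $ i\<close>; as C is
      nonempty, the truncated subtraction in the cardinality agrees with the real one.\<close>
    have "(\<Sum>j\<in>Q. X $ i $ j) - X $ i $ i = (\<Sum>h\<in>C - {c}. X $ c $ h)"
      using row c block False
      by (simp add: of_nat_diff Suc_leI card_gt_0_iff algebra_simps)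
    also have "\<dots> = (\<Sum>(j, h)\<in>Pair c ` (C - {c}). X $ j $ h)"
      by (simp add: sum.reindex inj_on_def)
    also have "\<dots> \<le> (\<Sum>(j, h) | ?P j h. X $ j $ h)"
      using pairs by (intro sum_mono2) (auto simp: nonneg)
    finally show ?thesis .
  qed
qed

text \<open>Selecting rows and columns is multiplication by 0/1 matrices on both sides, which cannot
  raise the rank. With \<open>Inl\<close> or \<open>Inr\<close> as both selectors this covers the
  diagonal blocks.\<close>

lemma rank_submatrix_le:
  fixes Z :: "real^'n^'m" and f :: "'p::finite \<Rightarrow> 'm" and g :: "'q::finite \<Rightarrow> 'n"
  shows "rank (\<chi> i j. Z $ f i $ g j :: real^'q^'p) \<le> rank Z"
proof -
  define L :: "real^'m^'p" where "L = (\<chi> i a. if a = f i then 1 else 0)"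
  define R :: "real^'q^'n" where "R = (\<chi> b j. if b = g j then 1 else 0)"
  have "(\<chi> i j. Z $ f i $ g j) = L ** (Z ** R)"
    by (simp add: L_def R_def matrix_matrix_mult_def vec_eq_iff if_distrib if_distribR cong: if_cong)
  then show ?thesis
    using rank_mul_le_right[of L "Z ** R"] rank_mul_le_left[of Z R] by simp
qed

lemma hypermetric_if_rank_le_trace:
  fixes X :: "real^('n::{finite,linorder})^('n::{finite,linorder})"
  assumes "symmetric_stochastic X" and "real (rank X) \<le> trace X"
  shows "(\<Sum>j\<in>Q. X $ i $ j) - X $ i $ i \<le> (\<Sum>(j, h) | j \<in> Q \<and> h \<in> Q \<and> j < h. X $ j $ h)"
  using assms hypermetric_if_idempotent symmetric_stochastic.idempotent_if_rank_le_trace by blast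

theorem proposition4p2:
  fixes A :: "real^('m::{finite,linorder})^('n::{finite,linorder})"
    and k p :: nat
  assumes "2 \<le> k" and "k \<le> min CARD('n) CARD('m)"
    and "1 \<le> p" and "p \<le> k"
  shows "(\<forall>(i::'n) Q. Q \<subseteq> UNIV - {i} \<and> 1 \<le> card Q \<and> card Q \<le> p \<longrightarrow>
            valid_for (rank_problem A k) (\<lambda>Z.
              (\<Sum>(j, h) | j \<in> Q \<and> h \<in> Q \<and> j < h. block_UU Z $ j $ h)
                \<ge> (\<Sum>j\<in>Q. block_UU Z $ i $ j) - block_UU Z $ i $ i)) \<and>
         (\<forall>(i::'m) Q. Q \<subseteq> UNIV - {i} \<and> 1 \<le> card Q \<and> card Q \<le> p \<longrightarrow>
            valid_for (rank_problem A k) (\<lambda>Z.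
              (\<Sum>(j, h) | j \<in> Q \<and> h \<in> Q \<and> j < h. block_VV Z $ j $ h)
                \<ge> (\<Sum>j\<in>Q. block_VV Z $ i $ j) - block_VV Z $ i $ i))"
proof -
  have blocks: "symmetric_stochastic (block_UU Z) \<and> real (rank (block_UU Z)) \<le> trace (block_UU Z) \<and>
      symmetric_stochastic (block_VV Z) \<and> real (rank (block_VV Z)) \<le> trace (block_VV Z)"
    if "Z \<in> feasible_set (rank_problem A k)" for Z
  proof -
    have Z: "transpose Z = Z" "block_UU Z *v 1 = 1" "block_VV Z *v 1 = 1" "trace (block_UU Z) = real k"
        "trace (block_VV Z) = real k" "0 \<le> Z $ a $ b" "rank Z = k" for a b
      using that by (auto simp: rank_problem_def relaxed_feasible_set_def)
    have "Z $ a $ b = Z $ b $ a" for a b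
      using arg_cong[OF Z(1), of "\<lambda>Y. Y $ b $ a"] by (simp add: transpose_def)
    then have "transpose (block_UU Z) = block_UU Z" "transpose (block_VV Z) = block_VV Z"
      by (auto simp: transpose_def block_UU_def block_VV_def vec_eq_iff)
    then have "symmetric_stochastic (block_UU Z)" "symmetric_stochastic (block_VV Z)"
      using Z(2,3,6) by (auto intro!: symmetric_stochastic.intro simp: block_UU_def block_VV_def)
    \<comment> \<open>This is where the rank constraint enters: each block has trace k, and its rank
      is at most that of \<open>Z\<close>, which is k.\<close>
    moreover have "rank (block_UU Z) \<le> k" "rank (block_VV Z) \<le> k"
      using rank_submatrix_le[of Z] Z(7) by (auto simp: block_UU_def block_VV_def)
    ultimately show ?thesis
      using Z by simp
  qed
  show ?thesis
    unfolding valid_for_def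
    by (intro conjI allI impI ballI hypermetric_if_rank_le_trace) (drule blocks, simp)+
qed

end
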